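(* Fix $\gamma\in(0,2)$ and $\theta\in[-\frac\pi2,\frac\pi2]$. Let $(\widehat{\mathbb C},h,0,\infty)$ be a unit-area $\gamma$-Liouville quantum sphere with $\gamma$-LQG area measure $\mu_h$, let $\widehat h$ be an independent whole-plane Gaussian free field (modulo a global additive integer multiple of $2\pi\chi$), and let $\eta'_0$, $\eta'_{\theta-\frac\pi2}$ be the space-filling SLE$_{\kappa'}$ counterflow lines of $\widehat h$ from $\infty$ to $\infty$ with angles $0$ and $\theta-\frac\pi2$, parametrized by $[0,1]$ so that $\eta'_0(0)=\eta'_0(1)=\eta'_{\theta-\frac\pi2}(0)=\eta'_{\theta-\frac\pi2}(1)=\infty$ and $\mu_h(\eta'_0([s,t]))=\mu_h(\eta'_{\theta-\frac\pi2}([s,t]))=t-s$ for $0\le s<t\le1$. For $t\in[0,1]$ let $\psi_{\gamma,\theta}(t)$ be the first time at which $\eta'_{\theta-\frac\pi2}$ hits the point $\eta'_0(t)$, and let $\mu_{\rho,q}:=(\mathrm{Id},\psi_{\gamma,\theta})_*\mathrm{Leb}$ be the push-forward of Lebesgue measure on $[0,1]$ under $t\mapsto(t,\psi_{\gamma,\theta}(t))$, which is a skew Brownian permuton of parameters $\rho=-\cos(\pi\gamma^2/4)$ and $q=q_\gamma(\theta)$. Then, almost surely, for every $0\le x_1\le x_2\le1$ and $0\le y_1\le y_2\le1$, $$\mu_{\rho,q}\big([x_1,x_2]\times[y_1,y_2]\big)=\mu_h\big(\eta'_0([x_1,x_2])\cap\eta'_{\theta-\frac\pi2}([y_1,y_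2])\big).$$
   Context: Parameters: $Q=\frac2\gamma+\frac\gamma2$, $\chi=\frac2\gamma-\frac\gamma2$, $\kappa=\gamma^2$, $\kappa'=16/\gamma^2$, $\lambda'=\pi\sqrt\kappa/4$. Quantum surfaces. A quantum surface with marked points is an equivalence class of tuples $(D,h,x_1,\dots,x_k)$ ($D\subseteq\widehat{\mathbb C}$ a domain, $h$ a distribution, $x_i\in\overline D$) under $(D,h)\sim_\gamma(\widetilde D,\widetilde h)$ if $\widetilde h=h\circ\varphi+Q\log|\varphi'|$ for a conformal map $\varphi:\widetilde D\to D$ matching the marked points. For $h$ a variant of the Gaussian free field (GFF), $\mu_h$ is the $\gamma$-LQG area measure, the weak limit of $\varepsilon^{\gamma^2/2}e^{\gamma h_\varepsilon(z)}dz$ as $\varepsilon\to0$, with $h_\varepsilon(z)$ the average of $h$ on $\partial B_\varepsilon(z)$. Quantum sphere of weight $W>0$. Let $\alpha=Q-\frac{W}{2\gamma}$, let $B,\widetilde B$ be independent standard Brownian motions, and let $\mathbf c$ be sampled independently from the infinite measure $\frac\gamma2e^{2(\alpha-Q)c}dc$ on $\mathbb R$. Let $X_t=B_t+\alpha t+\mathbf c$ for $t\ge0$ and $X_t=\widetilde B_{-t}+(2Q-\alpha)t+\mathbf c$ for $t<0$, conditioned on $B_t-(Q-\alpha)t<0$ and $\widetilde B_t-(Q-\alpha)t<0$ for all $t>0$ (made rigorous by a limiting procedure). Let $h_2$ be the projection of an independent whole-plane GFF onto functions with mean zero on all circles centered at $0$. The law of $(\widehat{\mathbb C},X_{-\log|\cdot|}+h_2,0,\infty)/\!\sim_\gamma$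 is the infinite measure $\mathcal M_2^{\mathrm{sph}}(W)$. The unit-area $\gamma$-quantum sphere is the weight $4-\gamma^2$ quantum sphere conditioned to have total $\gamma$-LQG area $1$. Flow lines and counterflow lines (Miller–Sheffield imaginary geometry). Let $\widehat h$ be a whole-plane GFF modulo a global additive integer multiple of $2\pi\chi$. For $z\in\mathbb C$, $\vartheta\in\mathbb R$, the angle-$\vartheta$ flow line $\eta_\vartheta^z$ is the flow line of $e^{i(\widehat h/\chi+\vartheta)}$ from $z$ to $\infty$: the random path determined by $\widehat h$, with marginal law whole-plane SLE$_\kappa(2-\kappa)$ from $z$ to $\infty$, such that for each stopping time $\tau$ the conditional law of $\widehat h$ given $\eta^z_\vartheta|_{[0,\tau]}$ is that of a zero-boundary GFF in the complement of $\eta^z_\vartheta([0,\tau])$ plus the harmonic function with boundary values $-\lambda'-\vartheta\chi$ (left side) and $\lambda'-\vartheta\chi$ (right side) plus $\chi$ times the winding of the curve relative to a segment going straight upwards. Angles are measured counterclockwise and angle $0$ is north. Flow lines of the same angle merge upon intersecting. For $\vartheta\in\mathbb R$, order $\mathbb Q^2$ by: $z\preceq w$ iff $z$ lies in a connected component of $\mathbb C\setminus(\eta_\vartheta^w\cup\eta_{\vartheta-\pi}^w)$ to the left of $\eta_\vartheta^w$ and to the right of $\eta_{\vartheta-\pi}^w$. The space-filling SLE$_{\kappa'}$ counterflow line $\eta'_{\vartheta-\frac\pi2}$ of angle $\vartheta-\frac\pi2$ is the unique continuous space-filling curve from $\infty$ to $\infty$ visiting the points of $\mathbb Q^2$ in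 this order; $\eta_0'$ corresponds to $\vartheta=\pi/2$. A.s., for fixed $z$, $\eta_\vartheta^z$ and $\eta_{\vartheta-\pi}^z$ are the left and right boundaries of $\eta'_{\vartheta-\frac\pi2}$ stopped upon hitting $z$. Skew Brownian permuton. Let $\rho\in(-1,1)$, $q\in[0,1]$. Let $E_\rho=(X_\rho,Y_\rho)$ on $[0,1]$ be a planar Brownian motion with standard components and $\mathrm{Cov}(X_\rho(t),Y_\rho(s))=\rho\min\{t,s\}$, started at $0$, conditioned to stay in $\mathbb R_{\ge0}^2$ and to end at $0$ at time $1$. For $u\in[0,1]$ let $Z^{(u)}$ solve $dZ^{(u)}(t)=\mathbf 1_{\{Z^{(u)}(t)\ge0\}}dY_\rho(t)-\mathbf 1_{\{Z^{(u)}(t)<0\}}dX_\rho(t)+(2q-1)dL^{Z^{(u)}}(t)$ on $(u,1)$ with $Z^{(u)}=0$ on $[0,u]$ ($L$ the symmetric local time at $0$). With $\varphi(t)=\mathrm{Leb}(\{x\in[0,t):Z^{(x)}(t)<0\}\cup\{x\in[t,1]:Z^{(t)}(x)\ge0\})$, the skew Brownian permuton of parameters $\rho,q$ is the push-forward of Lebesgue measure on $[0,1]$ under $t\mapsto(t,\varphi(t))$. It is known (Borga) that for each $\gamma\in(0,2)$ there is a decreasing homeomorphism $q_\gamma:[-\frac\pi2,\frac\pi2]\to[0,1]$ such that $(\mathrm{Id},\psi_{\gamma,\theta})_*\mathrm{Leb}$ has the law of the skew Brownian permuton with $\rho=-\cos(\pi\gamma^2/4)\in(-1,1)$ and $q=q_\gamma(\theta)$.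 *)

theory Defs
  imports
    "HOL-Probability.Probability"
    "HOL-Probability.Stopping_Time"
    "HOL-Complex_Analysis.Complex_Analysis"
    "HOL-Library.Real_Mod"
begin

section \<open>Distributions on the plane\<close>

definition dir_deriv :: "complex \<Rightarrow> (complex \<Rightarrow> real) \<Rightarrow> complex \<Rightarrow> real" where
  "dir_deriv v f z = frechet_derivative f (at z) v"

definition smooth_fun :: "(complex \<Rightarrow> real) \<Rightarrow> bool" where
  "smooth_fun f \<longleftrightarrow> (\<forall>vs z. fold dir_deriv vs f differentiable (at z))"

definition test_fun :: "(complex \<Rightarrow> real) \<Rightarrow> bool" where
  "test_fun \<phi> \<longleftrightarrow> smooth_fun \<phi> \<and> compact (closure {z. \<phi> z \<noteq> 0})"

definition mean_zero_tests :: "(complex \<Rightarrow> real) set" where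
  "mean_zero_tests = {\<phi>. test_fun \<phi> \<and> (LINT z|lborel. \<phi> z) = 0}"

type_synonym functional = "(complex \<Rightarrow> real) \<Rightarrow> real"

text \<open>Only the values on test functions are meaningful; a functional is unconstrained elsewhere.\<close>

definition distribution :: "functional \<Rightarrow> bool" where
  "distribution h \<longleftrightarrow>
     (\<forall>\<phi> \<psi>. test_fun \<phi> \<longrightarrow> test_fun \<psi> \<longrightarrow> h (\<lambda>z. \<phi> z + \<psi> z) = h \<phi> + h \<psi>) \<and>
     (\<forall>c \<phi>. test_fun \<phi> \<longrightarrow> h (\<lambda>z. c * \<phi> z) = c * h \<phi>) \<and>
     (\<forall>\<Phi> \<phi>. (\<forall>n. test_fun (\<Phi> n)) \<longrightarrow> test_fun \<phi> \<longrightarrow>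
        (\<exists>K. compact K \<and> (\<forall>n::nat. \<forall>z. z \<notin> K \<longrightarrow> \<Phi> n z = 0)) \<longrightarrow>
        (\<forall>vs. uniform_limit UNIV (\<lambda>n. fold dir_deriv vs (\<Phi> n)) (fold dir_deriv vs \<phi>) sequentially) \<longrightarrow>
        (\<lambda>n. h (\<Phi> n)) \<longlonglongrightarrow> h \<phi>)"

definition dist_algebra :: "functional measure" where
  "dist_algebra = sigma (Collect distribution)
     {{h. distribution h \<and> h \<phi> \<in> A} | \<phi> A. test_fun \<phi> \<and> A \<in> sets (borel :: real measure)}"

definition rv_events :: "'a measure \<Rightarrow> 'b measure \<Rightarrow> ('a \<Rightarrow> 'b) \<Rightarrow> 'a set set" where
  "rv_events M N X = {X -` A \<inter> space M | A. A \<in> sets N}"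


section \<open>The area measure of Liouville quantum gravity\<close>

definition Q_lqg :: "real \<Rightarrow> real" where
  "Q_lqg \<gamma> = 2 / \<gamma> + \<gamma> / 2"

definition chi :: "real \<Rightarrow> real" where
  "chi \<gamma> = 2 / \<gamma> - \<gamma> / 2"

definition circle_mean :: "(complex \<Rightarrow> real) \<Rightarrow> real \<Rightarrow> complex \<Rightarrow> real" where
  "circle_mean \<phi> \<epsilon> z = (LBINT s:{0..2*pi}. \<phi> (z + of_real \<epsilon> * cis s)) / (2 * pi)"

text \<open>The circle average of a distribution is defined by duality: it is the continuous function
  representing the convolution of the distribution with the uniform law on the circle of radius
  \<open>\<epsilon>\<close> around the origin.\<close>

definition circle_average :: "functional \<Rightarrow> (real \<Rightarrow> complex \<Rightarrow> real) \<Rightarrow> bool" where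
  "circle_average h a \<longleftrightarrow>
     continuous_on ({0<..} \<times> UNIV) (\<lambda>(\<epsilon>, z). a \<epsilon> z) \<and>
     (\<forall>\<epsilon>>0. \<forall>\<phi>. test_fun \<phi> \<longrightarrow> (LINT z|lborel. a \<epsilon> z * \<phi> z) = h (circle_mean \<phi> \<epsilon>))"

definition is_lqg_area :: "real \<Rightarrow> functional \<Rightarrow> complex measure \<Rightarrow> bool" where
  "is_lqg_area \<gamma> h \<mu> \<longleftrightarrow>
     sets \<mu> = sets borel \<and> (\<forall>K. compact K \<longrightarrow> emeasure \<mu> K < \<infinity>) \<and>
     (\<exists>a. circle_average h a \<and>
       (\<forall>f :: complex \<Rightarrow> real. continuous_on UNIV f \<longrightarrow> compact (closure {z. f z \<noteq> 0}) \<longrightarrow>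
          ((\<lambda>\<epsilon>. LINT z|lborel. f z * (\<epsilon> powr (\<gamma>\<^sup>2 / 2) * exp (\<gamma> * a \<epsilon> z)))
             \<longlongrightarrow> (LINT z|\<mu>. f z)) (at_right 0)))"

text \<open>The null measure is a junk value for distributions without an area measure.\<close>

definition lqg_area :: "real \<Rightarrow> functional \<Rightarrow> complex measure" where
  "lqg_area \<gamma> h = (if \<exists>\<mu>. is_lqg_area \<gamma> h \<mu> then SOME \<mu>. is_lqg_area \<gamma> h \<mu> else null_measure borel)"

text \<open>The Riemann sphere is the one-point compactification of the plane, with \<open>None\<close> as the point at
  infinity. The area measure has no atom there.\<close>

abbreviation sphere_top :: "complex option topology" where
  "sphere_top \<equiv> Alexandroff_compactification euclidean"

definition sphere_borel :: "complex option measure" where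
  "sphere_borel = sigma UNIV {U. openin sphere_top U}"

definition sphere_area :: "real \<Rightarrow> functional \<Rightarrow> complex option measure" where
  "sphere_area \<gamma> h = distr (lqg_area \<gamma> h) sphere_borel Some"


section \<open>Whole-plane Gaussian free fields\<close>

definition centered_gaussian :: "'a measure \<Rightarrow> ('a \<Rightarrow> real) \<Rightarrow> real \<Rightarrow> bool" where
  "centered_gaussian M X v \<longleftrightarrow> X \<in> borel_measurable M \<and>
     (\<forall>t. char (distr M borel X) t = of_real (exp (- v * t\<^sup>2 / 2)))"

text \<open>Any representative of the field modulo additive constants; the covariance kernel is
  \<open>- ln \<bar>x - y\<bar>\<close>.\<close>

definition whole_plane_gff :: "'a measure \<Rightarrow> ('a \<Rightarrow> functional) \<Rightarrow> bool" where
  "whole_plane_gff M g \<longleftrightarrow> g \<in> M \<rightarrow>\<^sub>M dist_algebra \<and>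
     (\<forall>\<phi>\<in>mean_zero_tests. centered_gaussian M (\<lambda>\<omega>. g \<omega> \<phi>)
        (- (LINT x|lborel. LINT y|lborel. ln (cmod (x - y)) * \<phi> x * \<phi> y)))"

text \<open>Any representative of the field modulo additive constants in \<open>r\<int>\<close>. The additive constant is
  uniform modulo \<open>r\<close> and independent of the field modulo additive constants.\<close>

definition whole_plane_gff_mod :: "'a measure \<Rightarrow> real \<Rightarrow> ('a \<Rightarrow> functional) \<Rightarrow> bool" where
  "whole_plane_gff_mod M r g \<longleftrightarrow> whole_plane_gff M g \<and>
     (\<exists>\<phi>\<^sub>0. test_fun \<phi>\<^sub>0 \<and> (LINT z|lborel. \<phi>\<^sub>0 z) = 1 \<and>
        distr M lborel (\<lambda>\<omega>. g \<omega> \<phi>\<^sub>0 rmod r) = uniform_measure lborel {0..<r} \<and>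
        prob_space.indep_set M
          (rv_events M (Pi\<^sub>M mean_zero_tests (\<lambda>_. borel)) (\<lambda>\<omega>. restrict (g \<omega>) mean_zero_tests))
          (rv_events M borel (\<lambda>\<omega>. g \<omega> \<phi>\<^sub>0 rmod r)))"

definition shift_invariant :: "real \<Rightarrow> functional set \<Rightarrow> bool" where
  "shift_invariant r A \<longleftrightarrow> (\<forall>h\<in>A. \<forall>h'. \<forall>k::int. distribution h' \<longrightarrow>
     (\<forall>\<phi>. test_fun \<phi> \<longrightarrow> h' \<phi> = h \<phi> + of_int k * r * (LINT z|lborel. \<phi> z)) \<longrightarrow> h' \<in> A)"

text \<open>The events determined by the field modulo additive constants in \<open>r\<int>\<close>.\<close>

definition mod_events :: "'a measure \<Rightarrow> real \<Rightarrow> ('a \<Rightarrow> functional) \<Rightarrow> 'a set set" where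
  "mod_events M r g = {g -` A \<inter> space M | A. A \<in> sets dist_algebra \<and> shift_invariant r A}"


section \<open>Quantum spheres\<close>

definition brownian :: "'a measure \<Rightarrow> ('a \<Rightarrow> real \<Rightarrow> real) \<Rightarrow> bool" where
  "brownian M B \<longleftrightarrow>
     (AE \<omega> in M. B \<omega> 0 = 0 \<and> continuous_on {0..} (B \<omega>)) \<and>
     (\<forall>s t. 0 \<le> s \<longrightarrow> s < t \<longrightarrow>
        distributed M lborel (\<lambda>\<omega>. B \<omega> t - B \<omega> s) (\<lambda>x. ennreal (normal_density 0 (sqrt (t - s)) x)) \<and>
        prob_space.indep_set M
          (rv_events M (Pi\<^sub>M {0..s} (\<lambda>_. borel)) (\<lambda>\<omega>. restrict (B \<omega>) {0..s}))
          (rv_events M borel (\<lambda>\<omega>. B \<omega> t - B \<omega> s)))"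

text \<open>Brownian motion conditioned on \<open>B\<^sub>t - b t < 0\<close> for all \<open>t > 0\<close>: the weak limit, as
  \<open>\<epsilon>\<close> decreases to zero, of Brownian motion conditioned on \<open>B\<^sub>t - b t < \<epsilon>\<close> for all \<open>t > 0\<close>.
  The auxiliary Brownian motion only enters through its law, so its probability space may be taken
  on the real line.\<close>

definition conditioned_brownian :: "'a measure \<Rightarrow> real \<Rightarrow> ('a \<Rightarrow> real \<Rightarrow> real) \<Rightarrow> bool" where
  "conditioned_brownian M b B \<longleftrightarrow>
     (\<forall>t\<ge>0. (\<lambda>\<omega>. B \<omega> t) \<in> borel_measurable M) \<and> (AE \<omega> in M. continuous_on {0..} (B \<omega>)) \<and>
     (\<exists>(P :: real measure) W. prob_space P \<and> brownian P W \<and>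
        (\<forall>\<epsilon>>0. {\<omega> \<in> space P. \<forall>t>0. W \<omega> t - b * t < \<epsilon>} \<in> sets P) \<and>
        (\<forall>(T :: nat \<Rightarrow> real) (F :: (nat \<Rightarrow> real) \<Rightarrow> real).
           (\<forall>i. 0 \<le> T i) \<longrightarrow> continuous_on UNIV F \<longrightarrow> bounded (range F) \<longrightarrow>
           ((\<lambda>\<epsilon>. (LINT \<omega>:{\<omega> \<in> space P. \<forall>t>0. W \<omega> t - b * t < \<epsilon>}|P. F (\<lambda>i. W \<omega> (T i)))
                  / measure P {\<omega> \<in> space P. \<forall>t>0. W \<omega> t - b * t < \<epsilon>})
              \<longlongrightarrow> (LINT \<omega>|M. F (\<lambda>i. B \<omega> (T i)))) (at_right 0)))"

definition sphere_process :: "real \<Rightarrow> real \<Rightarrow> (real \<Rightarrow> real) \<Rightarrow> (real \<Rightarrow> real) \<Rightarrow> real \<Rightarrow> real \<Rightarrow> real" where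
  "sphere_process \<gamma> \<alpha> B B' c t =
     (if 0 \<le> t then B t + \<alpha> * t + c else B' (- t) + (2 * Q_lqg \<gamma> - \<alpha>) * t + c)"

definition radial_mean :: "(complex \<Rightarrow> real) \<Rightarrow> complex \<Rightarrow> real" where
  "radial_mean \<phi> z = (LBINT s:{0..2*pi}. \<phi> (cis s * z)) / (2 * pi)"

text \<open>The second summand is the projection of \<open>g\<close> onto functions with mean zero on all circles
  around the origin, written in terms of the dual projection of the test function.\<close>

definition sphere_field ::
  "real \<Rightarrow> real \<Rightarrow> (real \<Rightarrow> real) \<Rightarrow> (real \<Rightarrow> real) \<Rightarrow> functional \<Rightarrow> real \<Rightarrow> functional" where
  "sphere_field \<gamma> \<alpha> B B' g c \<phi> =
     (LINT z|lborel. sphere_process \<gamma> \<alpha> B B' c (- ln (cmod z)) * \<phi> z)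
     + g (\<lambda>z. \<phi> z - radial_mean \<phi> z)"

text \<open>\<open>\<nu>\<close> is the infinite law of the field of the weight-\<open>W\<close> quantum sphere in the embedding in which
  it is constructed.\<close>

definition weighted_quantum_sphere :: "real \<Rightarrow> real \<Rightarrow> functional measure \<Rightarrow> bool" where
  "weighted_quantum_sphere \<gamma> W \<nu> \<longleftrightarrow>
     (let \<alpha> = Q_lqg \<gamma> - W / (2 * \<gamma>);
          C = density lborel (\<lambda>c. ennreal (\<gamma> / 2 * exp (2 * (\<alpha> - Q_lqg \<gamma>) * c)))
      in \<exists>(P :: real measure) B B' g.
        prob_space P \<and>
        conditioned_brownian P (Q_lqg \<gamma> - \<alpha>) B \<and>
        conditioned_brownian P (Q_lqg \<gamma> - \<alpha>) B' \<and>
        whole_plane_gff P g \<and>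
        prob_space.indep_sets P (\<lambda>i::nat.
          [rv_events P (Pi\<^sub>M {0..} (\<lambda>_. borel)) (\<lambda>\<omega>. restrict (B \<omega>) {0..}),
           rv_events P (Pi\<^sub>M {0..} (\<lambda>_. borel)) (\<lambda>\<omega>. restrict (B' \<omega>) {0..}),
           rv_events P dist_algebra g] ! i) {..<3} \<and>
        (\<lambda>(\<omega>, c). sphere_field \<gamma> \<alpha> (B \<omega>) (B' \<omega>) (g \<omega>) c) \<in> (P \<Otimes>\<^sub>M C) \<rightarrow>\<^sub>M dist_algebra \<and>
        \<nu> = distr (P \<Otimes>\<^sub>M C) dist_algebra
              (\<lambda>(\<omega>, c). sphere_field \<gamma> \<alpha> (B \<omega>) (B' \<omega>) (g \<omega>) c))"

text \<open>Conditioning on total area one, an event of measure zero, is the weak limit of conditioning on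
  total area in \<open>[1, 1 + \<delta>]\<close>.\<close>

definition area_near_one :: "real \<Rightarrow> real \<Rightarrow> functional set" where
  "area_near_one \<gamma> \<delta> =
     {h. distribution h \<and> ennreal 1 \<le> emeasure (lqg_area \<gamma> h) UNIV
                         \<and> emeasure (lqg_area \<gamma> h) UNIV \<le> ennreal (1 + \<delta>)}"

definition unit_area_conditioning :: "real \<Rightarrow> functional measure \<Rightarrow> functional measure \<Rightarrow> bool" where
  "unit_area_conditioning \<gamma> \<nu> \<nu>\<^sub>1 \<longleftrightarrow>
     prob_space \<nu>\<^sub>1 \<and> sets \<nu>\<^sub>1 = sets dist_algebra \<and>
     (\<forall>(\<Phi> :: nat \<Rightarrow> complex \<Rightarrow> real) (F :: (nat \<Rightarrow> real) \<Rightarrow> real).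
        (\<forall>i. test_fun (\<Phi> i)) \<longrightarrow> continuous_on UNIV F \<longrightarrow> bounded (range F) \<longrightarrow>
        ((\<lambda>\<delta>. (LINT h:area_near_one \<gamma> \<delta>|\<nu>. F (\<lambda>i. h (\<Phi> i))) / measure \<nu> (area_near_one \<gamma> \<delta>))
           \<longlongrightarrow> (LINT h|\<nu>\<^sub>1. F (\<lambda>i. h (\<Phi> i)))) (at_right 0))"

text \<open>\<open>h' = h \<circ> f + Q log \<bar>f'\<bar>\<close> for a conformal automorphism \<open>f\<close> of the sphere fixing zero and infinity,
  that is, a biholomorphic map of the plane fixing zero.\<close>

definition surface_equiv :: "real \<Rightarrow> functional \<Rightarrow> functional \<Rightarrow> bool" where
  "surface_equiv \<gamma> h h' \<longleftrightarrow>
     (\<exists>f. f holomorphic_on UNIV \<and> bij f \<and> f 0 = 0 \<and>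
        (\<forall>\<phi>. test_fun \<phi> \<longrightarrow>
           h' \<phi> = h (\<lambda>w. \<phi> (inv f w) * (cmod (deriv (inv f) w))\<^sup>2)
                + (LINT z|lborel. Q_lqg \<gamma> * ln (cmod (deriv f z)) * \<phi> z)))"

text \<open>\<open>h\<close> is an arbitrary embedding with marked points zero and infinity: equality in law is only required
  for the equivalence classes, that is, on events invariant under the equivalence of surfaces.\<close>

definition unit_area_quantum_sphere :: "real \<Rightarrow> 'a measure \<Rightarrow> ('a \<Rightarrow> functional) \<Rightarrow> bool" where
  "unit_area_quantum_sphere \<gamma> M h \<longleftrightarrow> h \<in> M \<rightarrow>\<^sub>M dist_algebra \<and>
     (\<exists>\<nu> \<nu>\<^sub>1. weighted_quantum_sphere \<gamma> (4 - \<gamma>\<^sup>2) \<nu> \<and> unit_area_conditioning \<gamma> \<nu> \<nu>\<^sub>1 \<and>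
        (\<forall>A\<in>sets dist_algebra.
           (\<forall>k k'. distribution k \<longrightarrow> distribution k' \<longrightarrow> surface_equiv \<gamma> k k' \<longrightarrow> (k \<in> A \<longleftrightarrow> k' \<in> A)) \<longrightarrow>
           emeasure M (h -` A \<inter> space M) = emeasure \<nu>\<^sub>1 A))"


section \<open>Whole-plane SLE\<close>

text \<open>The arguments \<open>a\<close> of the force point and \<open>b\<close> of the driving point of the stationary two-sided
  radial SLE\<open>\<^sub>\<kappa>(\<rho>)\<close> driving pair, in logarithmic capacity time: with \<open>cot\<close> of half of \<open>b - a\<close> denoted \<open>c\<close>,
  \<open>da = - c dt\<close> and \<open>db = \<surd>\<kappa> dB + (\<rho>/2) c dt\<close>. The noise is additive, so no stochastic integral is
  needed. For \<open>\<rho> > - 2\<close> the associated Bessel process has dimension \<open>1 + 2 (\<rho> + 2)/\<kappa> > 1\<close>, so the drift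
  is integrable across collisions of the two points.\<close>

definition sle_driving ::
  "'a measure \<Rightarrow> real \<Rightarrow> real \<Rightarrow> ('a \<Rightarrow> real \<Rightarrow> real) \<Rightarrow> ('a \<Rightarrow> real \<Rightarrow> real) \<Rightarrow> bool" where
  "sle_driving M \<kappa> \<rho> a b \<longleftrightarrow>
     (let S = (\<lambda>\<omega> t. (cis (a \<omega> t), b \<omega> t - a \<omega> t));
          c = (\<lambda>\<omega> t. cot ((b \<omega> t - a \<omega> t) / 2))
      in (\<forall>t. (\<lambda>\<omega>. a \<omega> t) \<in> borel_measurable M \<and> (\<lambda>\<omega>. b \<omega> t) \<in> borel_measurable M) \<and>
        (\<forall>s. distr M (Pi\<^sub>M UNIV (\<lambda>_. borel)) (\<lambda>\<omega> t. S \<omega> (t + s)) = distr M (Pi\<^sub>M UNIV (\<lambda>_. borel)) S) \<and>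
        (\<exists>B. (\<forall>s t. s < t \<longrightarrow>
               distributed M lborel (\<lambda>\<omega>. B \<omega> t - B \<omega> s) (\<lambda>x. ennreal (normal_density 0 (sqrt (t - s)) x)) \<and>
               prob_space.indep_set M
                 (rv_events M (Pi\<^sub>M {..s} (\<lambda>_. borel)) (\<lambda>\<omega>. restrict (S \<omega>) {..s}))
                 (rv_events M borel (\<lambda>\<omega>. B \<omega> t - B \<omega> s))) \<and>
           (AE \<omega> in M. continuous_on UNIV (a \<omega>) \<and> continuous_on UNIV (b \<omega>) \<and>
              (\<forall>t. 0 \<le> b \<omega> t - a \<omega> t \<and> b \<omega> t - a \<omega> t \<le> 2 * pi) \<and>
              (\<forall>s t. s \<le> t \<longrightarrow> set_integrable lborel {s..t} (c \<omega>) \<and>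
                 a \<omega> t - a \<omega> s = - (LBINT u:{s..t}. c \<omega> u) \<and>
                 b \<omega> t - b \<omega> s = sqrt \<kappa> * (B \<omega> t - B \<omega> s) + \<rho> / 2 * (LBINT u:{s..t}. c \<omega> u)))))"

text \<open>Curves from \<open>z\<close> to infinity are parametrised on \<open>[0, \<infinity>)\<close> by capacity, so logarithmic capacity
  time \<open>t\<close> corresponds to the parameter \<open>exp t\<close>.\<close>

definition outer_domain :: "(real \<Rightarrow> complex) \<Rightarrow> real \<Rightarrow> complex set" where
  "outer_domain \<eta> t = outside (\<eta> ` {0..exp t})"

definition loewner_curve ::
  "complex \<Rightarrow> (real \<Rightarrow> complex) \<Rightarrow> (real \<Rightarrow> complex) \<Rightarrow> (real \<Rightarrow> complex \<Rightarrow> complex) \<Rightarrow> bool" where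
  "loewner_curve z \<eta> W g \<longleftrightarrow>
     \<eta> 0 = z \<and> continuous_on {0..} \<eta> \<and> filterlim \<eta> at_infinity at_top \<and>
     (\<forall>t. g t holomorphic_on outer_domain \<eta> t \<and>
          bij_betw (g t) (outer_domain \<eta> t) (- cball 0 1) \<and>
          ((\<lambda>w. g t w / w) \<longlongrightarrow> of_real (exp (- t))) at_infinity \<and>
          (\<forall>w\<in>outer_domain \<eta> t.
             ((\<lambda>r. g r w) has_vector_derivative g t w * (W t + g t w) / (W t - g t w)) (at t))) \<and>
     (\<forall>w. w \<noteq> z \<longrightarrow> ((\<lambda>t. of_real (exp t) * g t w) \<longlongrightarrow> w - z) at_bot)"


section \<open>Flow lines\<close>

definition harmonic_on :: "complex set \<Rightarrow> (complex \<Rightarrow> real) \<Rightarrow> bool" where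
  "harmonic_on U u \<longleftrightarrow>
     u differentiable_on U \<and> (\<forall>v. dir_deriv v u differentiable_on U) \<and>
     (\<forall>v w. continuous_on U (dir_deriv w (dir_deriv v u))) \<and>
     (\<forall>z\<in>U. dir_deriv 1 (dir_deriv 1 u) z + dir_deriv \<i> (dir_deriv \<i> u) z = 0)"

definition is_green :: "complex set \<Rightarrow> (complex \<Rightarrow> complex \<Rightarrow> real) \<Rightarrow> bool" where
  "is_green U G \<longleftrightarrow> (\<forall>x\<in>U.
     (\<exists>k. harmonic_on U k \<and> (\<forall>y\<in>U - {x}. G x y = k y - ln (cmod (x - y)))) \<and>
     (\<forall>p\<in>frontier U. (G x \<longlongrightarrow> 0) (at p within U)) \<and>
     (\<exists>R. bounded (G x ` {y\<in>U. R \<le> cmod y})))"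

definition green :: "complex set \<Rightarrow> complex \<Rightarrow> complex \<Rightarrow> real" where
  "green U = (SOME G. is_green U G)"

text \<open>The branch of \<open>arg g'\<close> on \<open>D\<close> that vanishes at infinity.\<close>

definition arg_deriv :: "complex set \<Rightarrow> (complex \<Rightarrow> complex) \<Rightarrow> complex \<Rightarrow> real" where
  "arg_deriv D g w = Im ((SOME l. l holomorphic_on D \<and> (\<forall>v\<in>D. exp (l v) = deriv g v) \<and>
                                 ((\<lambda>v. Im (l v)) \<longlongrightarrow> 0) at_infinity) w)"

text \<open>The bounded harmonic function outside of the unit disc with boundary value \<open>v s\<close> at \<open>cis s\<close> for
  \<open>a < s < a + 2 \<pi>\<close>.\<close>

definition exterior_poisson :: "(real \<Rightarrow> real) \<Rightarrow> real \<Rightarrow> complex \<Rightarrow> real" where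
  "exterior_poisson v a w =
     (LBINT s:{a..a + 2 * pi}. v s * (((cmod w)\<^sup>2 - 1) / (cmod (cis s - w))\<^sup>2)) / (2 * pi)"

definition lambda' :: "real \<Rightarrow> real" where
  "lambda' \<gamma> = pi * \<gamma> / 4"

text \<open>The harmonic function on the outer domain \<open>D\<close> with flow line boundary values. The map \<open>g\<close> takes
  the right side of the curve to the arc from \<open>cis a\<close> counterclockwise to \<open>cis b\<close> (the image of the tip),
  and the left side to the remaining arc. At the boundary point with image \<open>cis s\<close>, the
  counterclockwise tangent of the boundary has angle \<open>s - arg g'\<close> relative to north. On the
  right side this is the winding of the curve; on the left side the curve runs in the opposite
  direction, and continuity of the winding at the tip makes it \<open>s - \<pi> - arg g'\<close>. Another choice of the
  arguments \<open>a\<close> and \<open>b\<close> changes the function by a multiple of \<open>2 \<pi> \<chi>\<close>.\<close>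

definition flow_harmonic ::
  "real \<Rightarrow> real \<Rightarrow> complex set \<Rightarrow> real \<Rightarrow> real \<Rightarrow> (complex \<Rightarrow> complex) \<Rightarrow> complex \<Rightarrow> real" where
  "flow_harmonic \<gamma> \<theta> D a b g w =
     exterior_poisson
       (\<lambda>s. if s < b then lambda' \<gamma> - \<theta> * chi \<gamma> + chi \<gamma> * s
            else - lambda' \<gamma> - \<theta> * chi \<gamma> + chi \<gamma> * (s - pi)) a (g w)
     - chi \<gamma> * arg_deriv D g w"

text \<open>The extension to the whole complement of \<open>\<eta> ` {0..s}\<close>. In a pocket cut off from infinity by the
  curve, the boundary values are those present when the pocket is closed.\<close>

definition flow_mean ::
  "real \<Rightarrow> real \<Rightarrow> (real \<Rightarrow> complex) \<Rightarrow> (real \<Rightarrow> real) \<Rightarrow> (real \<Rightarrow> real) \<Rightarrow> (real \<Rightarrow> complex \<Rightarrow> complex)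
     \<Rightarrow> real \<Rightarrow> complex \<Rightarrow> real" where
  "flow_mean \<gamma> \<theta> \<eta> a b g s w =
     Lim (at_left (Sup {t. t \<le> ln s \<and> w \<in> outer_domain \<eta> t}))
       (\<lambda>t. flow_harmonic \<gamma> \<theta> (outer_domain \<eta> t) (a t) (b t) (g t) w)"

definition path_filtration :: "'a measure \<Rightarrow> ('a \<Rightarrow> real \<Rightarrow> complex) \<Rightarrow> real \<Rightarrow> 'a measure" where
  "path_filtration M \<eta> s = sigma (space M)
     {(\<lambda>\<omega>. \<eta> \<omega> u) -` A \<inter> space M | u A. 0 \<le> u \<and> u \<le> s \<and> A \<in> sets borel}"

text \<open>The flow line from \<open>z\<close> of angle \<open>\<theta>\<close>. The conditional law of the field given the path up to \<open>\<tau>\<close> is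
  expressed by its characteristic functional on the test functions \<open>\<phi>\<close> for which \<open>exp (i (h, \<phi>))\<close> only
  depends on the field modulo \<open>2 \<pi> \<chi>\<close> and whose support is not hit before \<open>\<tau>\<close>. The completion only
  serves to make modifications on null sets harmless.\<close>

definition flow_line ::
  "real \<Rightarrow> 'a measure \<Rightarrow> ('a \<Rightarrow> functional) \<Rightarrow> real \<Rightarrow> complex \<Rightarrow> ('a \<Rightarrow> real \<Rightarrow> complex) \<Rightarrow> bool" where
  "flow_line \<gamma> M h \<theta> z \<eta> \<longleftrightarrow>
     (\<forall>s\<ge>0. (\<lambda>\<omega>. \<eta> \<omega> s) \<in> borel_measurable M \<and>
        (\<exists>Y \<in> borel_measurable (sigma (space M) (mod_events M (2 * pi * chi \<gamma>) h)).
           AE \<omega> in M. \<eta> \<omega> s = Y \<omega>)) \<and>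
     (\<exists>a b g.
        sle_driving M (\<gamma>\<^sup>2) (2 - \<gamma>\<^sup>2) a b \<and>
        (AE \<omega> in M. loewner_curve z (\<eta> \<omega>) (\<lambda>t. cis (b \<omega> t)) (g \<omega>)) \<and>
        (\<forall>\<tau> \<phi> A.
           stopping_time (path_filtration M \<eta>) \<tau> \<longrightarrow> (\<forall>\<omega>\<in>space M. 0 < \<tau> \<omega>) \<longrightarrow>
           test_fun \<phi> \<longrightarrow> chi \<gamma> * (LINT w|lborel. \<phi> w) \<in> \<int> \<longrightarrow>
           A \<in> sets (filtration.pre_sigma (space M) (path_filtration M \<eta>) \<tau>) \<longrightarrow>
           (\<forall>\<omega>\<in>A. \<eta> \<omega> ` {0..\<tau> \<omega>} \<inter> closure {w. \<phi> w \<noteq> 0} = {}) \<longrightarrow>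
           (CLINT \<omega>:A|completion M. iexp (h \<omega> \<phi>)) =
           (CLINT \<omega>:A|completion M.
              iexp (LINT w|lborel. flow_mean \<gamma> \<theta> (\<eta> \<omega>) (a \<omega>) (b \<omega>) (g \<omega>) (\<tau> \<omega>) w * \<phi> w) *
              of_real (exp (- (LINT x|lborel. LINT y|lborel.
                                 green (- (\<eta> \<omega> ` {0..\<tau> \<omega>})) x y * \<phi> x * \<phi> y) / 2)))))"


section \<open>Space-filling counterflow lines\<close>

text \<open>\<open>\<eta>\<close> and \<open>\<eta>'\<close> start at the same point and go to infinity. Let \<open>\<Gamma>\<close> be the reversal of \<open>\<eta>'\<close> followed by
  \<open>\<eta>\<close>, a non-crossing loop through infinity on the sphere. The winding number about zero of
  \<open>(\<Gamma> - p) / (\<Gamma> - p\<^sub>0)\<close> is one if \<open>p\<close> is to the left and \<open>p\<^sub>0\<close> to the right of \<open>\<Gamma>\<close>, zero if both are on the same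
  side, and minus one otherwise. It is constant for \<open>p\<close> in a component of the complement of \<open>\<Gamma>\<close>.\<close>

definition side_loop ::
  "(real \<Rightarrow> complex) \<Rightarrow> (real \<Rightarrow> complex) \<Rightarrow> complex \<Rightarrow> complex \<Rightarrow> real \<Rightarrow> complex" where
  "side_loop \<eta> \<eta>' p p\<^sub>0 t =
     (if t \<le> 0 \<or> 1 \<le> t then 1
      else let x = (if t < 1/2 then \<eta>' ((1 - 2 * t) / t) else \<eta> ((2 * t - 1) / (1 - t)))
           in (x - p) / (x - p\<^sub>0))"

definition between_left_right :: "(real \<Rightarrow> complex) \<Rightarrow> (real \<Rightarrow> complex) \<Rightarrow> complex \<Rightarrow> bool" where
  "between_left_right \<eta> \<eta>' p \<longleftrightarrow>
     p \<notin> \<eta> ` {0..} \<union> \<eta>' ` {0..} \<and>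
     (\<exists>p\<^sub>0. p\<^sub>0 \<notin> \<eta> ` {0..} \<union> \<eta>' ` {0..} \<and> winding_number (side_loop \<eta> \<eta>' p p\<^sub>0) 0 = 1)"

definition rational_points :: "complex set" where
  "rational_points = {z. Re z \<in> \<rat> \<and> Im z \<in> \<rat>}"

text \<open>The space-filling counterflow line of angle \<open>\<beta>\<close>, up to an increasing change of parametrisation of \<open>[0, 1]\<close>.
  Its left and right boundaries at \<open>w\<close> are the flow lines of angles \<open>\<beta> + \<pi>/2\<close> and \<open>\<beta> - \<pi>/2\<close>.\<close>

definition counterflow_line ::
  "real \<Rightarrow> 'a measure \<Rightarrow> ('a \<Rightarrow> functional) \<Rightarrow> real \<Rightarrow> ('a \<Rightarrow> real \<Rightarrow> complex option) \<Rightarrow> bool" where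
  "counterflow_line \<gamma> M h \<beta> \<eta>' \<longleftrightarrow>
     (\<exists>L R.
        (\<forall>w\<in>rational_points. flow_line \<gamma> M h (\<beta> + pi / 2) w (L w) \<and>
                              flow_line \<gamma> M h (\<beta> - pi / 2) w (R w)) \<and>
        (AE \<omega> in M.
           continuous_map (top_of_set {0..1}) sphere_top (\<eta>' \<omega>) \<and>
           \<eta>' \<omega> 0 = None \<and> \<eta>' \<omega> 1 = None \<and> \<eta>' \<omega> ` {0..1} = UNIV \<and>
           (\<forall>z\<in>rational_points. \<forall>w\<in>rational_points. z \<noteq> w \<longrightarrow>
              between_left_right (L w \<omega>) (R w \<omega>) z \<longrightarrow>
              (\<forall>s\<in>{0..1}. \<forall>t\<in>{0..1}. \<eta>' \<omega> s = Some z \<longrightarrow> \<eta>' \<omega> t = Some w \<longrightarrow> s < t))))"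


section \<open>The permuton\<close>

definition first_hit :: "(real \<Rightarrow> complex option) \<Rightarrow> complex option \<Rightarrow> real" where
  "first_hit \<eta> p = Inf {s\<in>{0..1}. \<eta> s = p}"

definition graph_measure :: "(real \<Rightarrow> real) \<Rightarrow> (real \<times> real) measure" where
  "graph_measure \<psi> = distr (restrict_space lborel {0..1}) borel (\<lambda>t. (t, \<psi> t))"

end

theory Submission
  imports Defs
begin

text \<open>The statement holds pathwise. An area-parametrized space-filling curve carries Lebesgue measure
  on \<open>[0, 1]\<close> to the area measure, and almost every point is visited only once: a point visited at times
  \<open>s < t\<close> lies in \<open>\<eta>[0, r] \<inter> \<eta>[r, 1]\<close> for a rational \<open>r\<close>, and this overlap is null because the areas \<open>r\<close> and \<open>1 - r\<close>
  already exhaust the total mass. Hence, off a null set of times \<open>t\<close>, \<open>\<eta>\<^sub>0(t)\<close> lies in both arcs if and only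
  if \<open>t \<in> [x\<^sub>1, x\<^sub>2]\<close> and the first hitting time of \<open>\<eta>\<^sub>0(t)\<close> by \<open>\<eta>\<^sub>\<theta>\<close> lies in \<open>[y\<^sub>1, y\<^sub>2]\<close>.\<close>

locale area_parametrized_curve =
  fixes \<mu> :: "complex option measure" and \<eta> :: "real \<Rightarrow> complex option"
  assumes sets_area [measurable_cong]: "sets \<mu> = sets sphere_borel"
    and curve_continuous: "continuous_map (top_of_set {0..1}) sphere_top \<eta>"
    and space_filling: "\<eta> ` {0..1} = UNIV"
    and area_arc_strict: "\<lbrakk>0 \<le> s; s < t; t \<le> 1\<rbrakk> \<Longrightarrow> emeasure \<mu> (\<eta> ` {s..t}) = ennreal (t - s)"

section \<open>Topology and Borel sets of the Riemann sphere\<close>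

lemma space_sphere_borel [simp]: "space sphere_borel = UNIV"
  by (simp add: sphere_borel_def space_measure_of_conv)

lemma topspace_sphere: "topspace sphere_top = UNIV"
  by (auto simp: UNIV_option_conv)

lemma Hausdorff_sphere: "Hausdorff_space sphere_top"
  by (simp add: Hausdorff_space_Alexandroff_compactification locally_compact_space_euclidean)

lemma sets_sphere_borel_open: "openin sphere_top U \<Longrightarrow> U \<in> sets sphere_borel"
  by (simp add: sphere_borel_def)

lemma sets_sphere_borel_closed:
  assumes "closedin sphere_top C" shows "C \<in> sets sphere_borel"
proof -
  have "UNIV - C \<in> sets sphere_borel"
    using assms by (intro sets_sphere_borel_open) (metis openin_closedin_eq topspace_sphere closedin_def)
  then have "space sphere_borel - (UNIV - C) \<in> sets sphere_borel"
    by (rule sets.compl_sets)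
  then show ?thesis by (simp add: Diff_Diff_Int)
qed

context area_parametrized_curve
begin

section \<open>Areas of arcs of the curve\<close>

lemma space_area [simp]: "space \<mu> = UNIV"
  using sets_eq_imp_space_eq[OF sets_area] by simp

text \<open>A continuous image of a compact interval is compact, hence closed in the Hausdorff
  sphere; this is what makes arcs measurable.\<close>

lemma closedin_arc:
  assumes "0 \<le> s" "t \<le> 1" shows "closedin sphere_top (\<eta> ` {s..t})"
proof -
  have "compactin (top_of_set {0..1}) {s..t}"
    using assms by (simp add: compactin_subtopology)
  then show ?thesis
    by (rule compactin_imp_closedin[OF Hausdorff_sphere image_compactin[OF _ curve_continuous]])
qed

lemma arc_sets: "\<lbrakk>0 \<le> s; t \<le> 1\<rbrakk> \<Longrightarrow> \<eta> ` {s..t} \<in> sets \<mu>"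
  by (simp add: sets_area sets_sphere_borel_closed closedin_arc)

text \<open>The case s = t is the new one: a single visited point has area zero because it lies on
  arcs of arbitrarily small area.\<close>

lemma area_arc:
  assumes "0 \<le> s" "s \<le> t" "t \<le> 1"
  shows "emeasure \<mu> (\<eta> ` {s..t}) = ennreal (t - s)"
proof (cases "s = t")
  case False
  with assms area_arc_strict show ?thesis by simp
next
  case True
  have "emeasure \<mu> (\<eta> ` {s..t}) \<le> 0 + ennreal e" if "0 < e" for e
  proof -
    \<comment> \<open>The cap 1/2 leaves room in [0, 1] for an interval of length d with s as its
      left end if s \<le> 1/2 and as its right end otherwise.\<close>
    define d where "d = min e (1/2)"
    have d: "0 < d" "d \<le> e" "d \<le> 1/2" using that by (auto simp: d_def)
    obtain a b where ab: "0 \<le> a" "a \<le> s" "t \<le> b" "b \<le> 1" "b - a = d"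
    proof (cases "s \<le> 1/2")
      case True with that[of s "s + d"] d \<open>s = t\<close> assms show ?thesis by auto
    next
      case False with that[of "s - d" s] d \<open>s = t\<close> assms show ?thesis by auto
    qed
    have "emeasure \<mu> (\<eta> ` {s..t}) \<le> emeasure \<mu> (\<eta> ` {a..b})"
      using ab by (intro emeasure_mono arc_sets image_mono) auto
    also have "\<dots> = ennreal d"
      using ab d area_arc_strict[of a b] by simp
    also have "\<dots> \<le> ennreal e" using d by (simp add: ennreal_leI)
    finally show ?thesis by simp
  qed
  then have "emeasure \<mu> (\<eta> ` {s..t}) \<le> 0"
    by (rule ennreal_le_epsilon)
  with True show ?thesis by simp
qed

text \<open>The arc over the full interval [0, 1] is the whole sphere, so its area 1 is the total
  mass.\<close>

sublocale prob_space \<mu>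
  using area_arc[of 0 1] space_filling by (intro prob_spaceI) simp

section \<open>First hitting times\<close>

lemma closed_hitting_times: "closed {s\<in>{0..1}. \<eta> s = p}"
proof -
  have "closedin sphere_top {p}"
    using Hausdorff_sphere topspace_sphere
    by (metis Hausdorff_imp_t1_space UNIV_I t1_space_closedin_singleton)
  then have "closedin (top_of_set {0..1}) {s \<in> topspace (top_of_set {0..1}). \<eta> s \<in> {p}}"
    using curve_continuous closedin_continuous_map_preimage by blast
  then show ?thesis
    by (auto intro: closedin_closed_trans)
qed

lemma
  shows first_hit_range: "first_hit \<eta> p \<in> {0..1}"
    and curve_first_hit [simp]: "\<eta> (first_hit \<eta> p) = p"
    and first_hit_le: "\<lbrakk>s \<in> {0..1}; \<eta> s = p\<rbrakk> \<Longrightarrow> first_hit \<eta> p \<le> s"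
proof -
  let ?S = "{s\<in>{0..1}. \<eta> s = p}"
  \<comment> \<open>Surjectivity excludes the infimum of an empty set; closedness then turns the
    infimum in \<open>first_hit\<close> into a minimum.\<close>
  have "p \<in> \<eta> ` {0..1}" by (simp only: space_filling UNIV_I)
  then have ne: "?S \<noteq> {}" by blast
  have bdd: "bdd_below ?S" by (auto intro: bdd_belowI[of _ 0])
  have "Inf ?S \<in> ?S" by (intro closed_contains_Inf ne bdd closed_hitting_times)
  then show "first_hit \<eta> p \<in> {0..1}" "\<eta> (first_hit \<eta> p) = p"
    by (auto simp: first_hit_def)
  show "first_hit \<eta> p \<le> s" if "s \<in> {0..1}" "\<eta> s = p"
    unfolding first_hit_def using that bdd by (intro cInf_lower) auto
qed

lemma first_hit_le_iff:
  assumes "0 \<le> t" "t \<le> 1" shows "first_hit \<eta> p \<le> t \<longleftrightarrow> p \<in> \<eta> ` {0..t}"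
proof
  assume "first_hit \<eta> p \<le> t"
  then show "p \<in> \<eta> ` {0..t}"
    using first_hit_range[of p] by (intro image_eqI[of _ _ "first_hit \<eta> p"]) auto
next
  assume "p \<in> \<eta> ` {0..t}"
  then obtain s where "s \<in> {0..t}" "\<eta> s = p" by auto
  with assms first_hit_le[of s p] show "first_hit \<eta> p \<le> t" by auto
qed

text \<open>Sublevel sets of the hitting time are initial arcs, which yields both its measurability
  and its distribution function. The case split and \<open>min t 1\<close> reflect that hitting
  times lie in [0, 1].\<close>

lemma first_hit_sublevel:
  "{p. first_hit \<eta> p \<le> t} = (if t < 0 then {} else \<eta> ` {0..min t 1})"
proof (cases "t < 0")
  case True
  have "\<not> first_hit \<eta> p \<le> t" for p
    using True first_hit_range[of p] by auto
  with True show ?thesis by auto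
next
  case False
  have "first_hit \<eta> p \<le> t \<longleftrightarrow> p \<in> \<eta> ` {0..min t 1}" for p
    using False first_hit_le_iff[of "min t 1" p] first_hit_range[of p] by auto
  with False show ?thesis by auto
qed

lemma measurable_first_hit [measurable]: "first_hit \<eta> \<in> borel_measurable \<mu>"
proof (rule borel_measurable_iff_le[THEN iffD2], intro allI)
  fix t show "{p \<in> space \<mu>. first_hit \<eta> p \<le> t} \<in> sets \<mu>"
    using arc_sets[of 0 "min t 1"] by (simp add: first_hit_sublevel)
qed

section \<open>Transport between Lebesgue measure and the area measure\<close>

abbreviation unit_interval :: "real measure" where
  "unit_interval \<equiv> restrict_space lborel {0..1}"

lemma measurable_curve [measurable]: "\<eta> \<in> unit_interval \<rightarrow>\<^sub>M \<mu>"
proof -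
  have "\<eta> \<in> unit_interval \<rightarrow>\<^sub>M sigma UNIV {U. openin sphere_top U}"
  proof (rule measurable_measure_of)
    fix U assume "U \<in> {U. openin sphere_top U}"
    then have "openin (top_of_set {0..1}) {s \<in> {0..1}. \<eta> s \<in> U}"
      using openin_continuous_map_preimage[OF curve_continuous] by simp
    then obtain V where "open V" "{s \<in> {0..1}. \<eta> s \<in> U} = {0..1} \<inter> V"
      by (auto simp: openin_open)
    moreover have "\<eta> -` U \<inter> space unit_interval = {s \<in> {0..1}. \<eta> s \<in> U}"
      by (auto simp: space_restrict_space)
    ultimately show "\<eta> -` U \<inter> space unit_interval \<in> sets unit_interval"
      by (auto simp: sets_restrict_space)
  qed auto
  then show ?thesis
    by (simp add: sphere_borel_def[symmetric] cong: measurable_cong_sets sets_area)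
qed

text \<open>Both distribution functions equal t on [0, 1]: on the left, t is the area of the initial
  arc up to time t. The identity map on the right only moves Lebesgue measure on the unit interval
  to the Borel sets of the line.\<close>

lemma distr_first_hit: "distr \<mu> borel (first_hit \<eta>) = distr unit_interval borel (\<lambda>t. t)"
proof (rule cdf_unique)
  interpret U: prob_space unit_interval
    by (rule prob_spaceI) (simp add: emeasure_restrict_space space_restrict_space)
  have id: "(\<lambda>t. t) \<in> borel_measurable unit_interval"
    by (simp add: measurable_restrict_space1)
  show "real_distribution (distr \<mu> borel (first_hit \<eta>))"
    by (intro real_distribution_distr) simp
  show "real_distribution (distr unit_interval borel (\<lambda>t. t))"
    by (intro U.real_distribution_distr id)
  show "cdf (distr \<mu> borel (first_hit \<eta>)) = cdf (distr unit_interval borel (\<lambda>t. t))"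
  proof
    fix t :: real
    have "cdf (distr \<mu> borel (first_hit \<eta>)) t = measure \<mu> {p. first_hit \<eta> p \<le> t}"
      by (simp add: cdf_def measure_distr vimage_def)
    also have "\<dots> = measure lborel ({..t} \<inter> {0..1})"
    proof (cases "t < 0")
      case True
      then have "{..t} \<inter> {0..1} = {}" by auto
      with True show ?thesis by (simp add: first_hit_sublevel)
    next
      case False
      then have "{..t} \<inter> {0..1} = {0..min t 1}" by auto
      with False area_arc[of 0 "min t 1"] show ?thesis
        by (simp add: first_hit_sublevel measure_def)
    qed
    also have "\<dots> = cdf (distr unit_interval borel (\<lambda>t. t)) t"
      by (simp add: cdf_def measure_distr[OF id] measure_restrict_space space_restrict_space)
    finally show "cdf (distr \<mu> borel (first_hit \<eta>)) t
        = cdf (distr unit_interval borel (\<lambda>t. t)) t" .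
  qed
qed

text \<open>The first hitting time is a section of the curve and carries the area measure to Lebesgue
  measure, so the curve carries Lebesgue measure back to the area measure.\<close>

lemma distr_curve: "distr unit_interval \<mu> \<eta> = \<mu>"
proof (rule measure_eqI)
  fix A assume "A \<in> sets (distr unit_interval \<mu> \<eta>)"
  then have A: "A \<in> sets \<mu>" by simp
  define T where "T = {t\<in>{0..1}. \<eta> t \<in> A}"
  have id: "(\<lambda>t. t) \<in> borel_measurable unit_interval"
    by (simp add: measurable_restrict_space1)
  have T: "\<eta> -` A \<inter> space unit_interval = T"
    by (auto simp: T_def space_restrict_space)
  \<comment> \<open>\<open>distr_first_hit\<close> compares measures on the whole line, so T must be
    Borel there and not only measurable in the unit interval.\<close>
  have "T \<in> sets unit_interval"
    using measurable_sets[OF measurable_curve A] T by simp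
  then have T_borel: "T \<in> sets borel"
    by (auto simp: sets_restrict_space)
  have "emeasure (distr unit_interval \<mu> \<eta>) A = emeasure unit_interval T"
    by (simp only: emeasure_distr[OF measurable_curve A] T)
  also have "\<dots> = emeasure (distr unit_interval borel (\<lambda>t. t)) T"
    using T_borel by (simp add: emeasure_distr[OF id] T_def space_restrict_space Int_def conj_ac)
  also have "\<dots> = emeasure (distr \<mu> borel (first_hit \<eta>)) T"
    by (simp add: distr_first_hit)
  also have "\<dots> = emeasure \<mu> (first_hit \<eta> -` T)"
    using T_borel by (simp add: emeasure_distr)
  also have "first_hit \<eta> -` T = A"
    using first_hit_range by (auto simp: T_def)
  finally show "emeasure (distr unit_interval \<mu> \<eta>) A = emeasure \<mu> A" .
qed simp

section \<open>Multiple points of the curve\<close>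

lemma arc_overlap_null:
  assumes "0 \<le> r" "r \<le> 1"
  shows "\<eta> ` {0..r} \<inter> \<eta> ` {r..1} \<in> null_sets \<mu>"
proof -
  let ?A = "\<eta> ` {0..r}" and ?B = "\<eta> ` {r..1}"
  have AB: "?A \<in> sets \<mu>" "?B \<in> sets \<mu>" using assms arc_sets by auto
  have "?A \<union> ?B = UNIV"
    using assms space_filling by (simp add: image_Un[symmetric] ivl_disj_un_two_touch)
  then have "measure \<mu> (?A \<union> ?B) = 1" using prob_space by simp
  moreover have "measure \<mu> ?A = r" "measure \<mu> ?B = 1 - r"
    using area_arc[of 0 r] area_arc[of r 1] assms by (simp_all add: measure_def)
  \<comment> \<open>Inclusion-exclusion: together with the next identity this reads 1 = r + (1 - r)
    - \<open>measure \<mu> (?A \<inter> ?B)\<close>.\<close>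
  moreover have "measure \<mu> (?A \<union> ?B) = measure \<mu> ?A + measure \<mu> (?B - ?A)"
    using AB by (intro measure_Un2) (auto simp: fmeasurable_eq_sets)
  moreover have "measure \<mu> (?B - ?A) = measure \<mu> ?B - measure \<mu> (?A \<inter> ?B)"
    using AB finite_measure_Diff'[of ?B ?A] by (simp add: Int_commute)
  ultimately have "measure \<mu> (?A \<inter> ?B) = 0" by simp
  with AB show ?thesis by (intro null_setsI) (simp_all add: emeasure_eq_measure)
qed

lemma AE_simple_point:
  "AE p in \<mu>. \<forall>s\<in>{0..1}. \<forall>t\<in>{0..1}. \<eta> s = p \<longrightarrow> \<eta> t = p \<longrightarrow> s = t"
proof -
  \<comment> \<open>Splitting times range over the countable type of rationals, so the union of the
    exceptional overlaps is still null.\<close>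
  have "AE p in \<mu>. \<forall>r::rat. 0 \<le> r \<and> r \<le> 1 \<longrightarrow>
      p \<notin> \<eta> ` {0..of_rat r} \<inter> \<eta> ` {of_rat r..1}"
    unfolding AE_all_countable
    using AE_not_in[OF arc_overlap_null] by (auto intro: AE_impI)
  then show ?thesis
  proof eventually_elim
    case (elim p)
    have False if st: "s \<in> {0..1}" "t \<in> {0..1}" "\<eta> s = p" "\<eta> t = p" "s < t" for s t
    proof -
      obtain r where r: "s < of_rat r" "of_rat r < t"
        using of_rat_dense[OF \<open>s < t\<close>] by auto
      \<comment> \<open>The bounds come from s and t and hence concern the real number; the deleted
        rules would replace it by the rational r too early.\<close>
      have "(0::real) \<le> of_rat r" "of_rat r \<le> (1::real)"
        using r st by (auto simp del: zero_le_of_rat_iff of_rat_le_1_iff)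
      then have "0 \<le> r" "r \<le> 1" by simp_all
      moreover have "p \<in> \<eta> ` {0..of_rat r} \<inter> \<eta> ` {of_rat r..1}"
        using r st image_eqI[of p \<eta> s] image_eqI[of p \<eta> t] by auto
      ultimately show False using elim by blast
    qed
    then show ?case by (metis linorder_neqE)
  qed
qed

end

section \<open>Mass of rectangles under the graph measure\<close>

lemma graph_measure_rectangle:
  assumes "area_parametrized_curve \<mu> \<eta>" and "area_parametrized_curve \<mu> \<zeta>"
    and "0 \<le> x\<^sub>1" "x\<^sub>2 \<le> 1" "0 \<le> y\<^sub>1" "y\<^sub>2 \<le> 1"
  shows "emeasure (graph_measure (\<lambda>t. first_hit \<zeta> (\<eta> t))) ({x\<^sub>1..x\<^sub>2} \<times> {y\<^sub>1..y\<^sub>2})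
    = emeasure \<mu> (\<eta> ` {x\<^sub>1..x\<^sub>2} \<inter> \<zeta> ` {y\<^sub>1..y\<^sub>2})"
proof -
  interpret \<eta>: area_parametrized_curve \<mu> \<eta> by fact
  interpret \<zeta>: area_parametrized_curve \<mu> \<zeta> by fact
  let ?U = "restrict_space lborel {0..1::real}"
  let ?B = "\<eta> ` {x\<^sub>1..x\<^sub>2} \<inter> \<zeta> ` {y\<^sub>1..y\<^sub>2}"
  let ?f = "\<lambda>t. (t, first_hit \<zeta> (\<eta> t))"
  have id [measurable]: "(\<lambda>t. t) \<in> borel_measurable ?U"
    by (simp add: measurable_restrict_space1)
  have f: "?f \<in> borel_measurable ?U"
    by (intro borel_measurable_Pair id measurable_compose[OF \<eta>.measurable_curve \<zeta>.measurable_first_hit])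
  have B: "?B \<in> sets \<mu>"
    using assms by (intro sets.Int \<eta>.arc_sets \<zeta>.arc_sets)
  have rect: "{x\<^sub>1..x\<^sub>2} \<times> {y\<^sub>1..y\<^sub>2} \<in> sets (borel :: (real \<times> real) measure)"
    by (intro borel_closed closed_Times) auto
  \<comment> \<open>Both curves are parametrized by the same area measure, so almost every point is
    simple for both. Writing that measure as the image of Lebesgue measure under
    \<open>\<eta>\<close> turns this into a statement about almost every time t, also for the visits
    of \<open>\<zeta>\<close>.\<close>
  have "AE p in distr ?U \<mu> \<eta>. (\<forall>s\<in>{0..1}. \<forall>t\<in>{0..1}. \<eta> s = p \<longrightarrow> \<eta> t = p \<longrightarrow> s = t) \<and>
      (\<forall>s\<in>{0..1}. \<forall>t\<in>{0..1}. \<zeta> s = p \<longrightarrow> \<zeta> t = p \<longrightarrow> s = t)"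
    unfolding \<eta>.distr_curve using \<eta>.AE_simple_point \<zeta>.AE_simple_point by eventually_elim blast
  then have simple: "AE t in ?U. (\<forall>s\<in>{0..1}. \<forall>s'\<in>{0..1}. \<eta> s = \<eta> t \<longrightarrow> \<eta> s' = \<eta> t \<longrightarrow> s = s') \<and>
      (\<forall>s\<in>{0..1}. \<forall>s'\<in>{0..1}. \<zeta> s = \<eta> t \<longrightarrow> \<zeta> s' = \<eta> t \<longrightarrow> s = s')"
    by (rule AE_distrD[OF \<eta>.measurable_curve])
  \<comment> \<open>The rectangle is pulled back along the graph map and the intersection of arcs
    along \<open>\<eta>\<close>; what remains is that the two sets of times agree up to a null
    set.\<close>
  have "emeasure (graph_measure (\<lambda>t. first_hit \<zeta> (\<eta> t))) ({x\<^sub>1..x\<^sub>2} \<times> {y\<^sub>1..y\<^sub>2})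
      = emeasure ?U (?f -` ({x\<^sub>1..x\<^sub>2} \<times> {y\<^sub>1..y\<^sub>2}) \<inter> space ?U)"
    unfolding graph_measure_def by (rule emeasure_distr[OF f rect])
  also have "\<dots> = emeasure ?U (\<eta> -` ?B \<inter> space ?U)"
  proof (rule emeasure_eq_AE)
    show "?f -` ({x\<^sub>1..x\<^sub>2} \<times> {y\<^sub>1..y\<^sub>2}) \<inter> space ?U \<in> sets ?U"
      by (rule measurable_sets[OF f rect])
    show "\<eta> -` ?B \<inter> space ?U \<in> sets ?U"
      by (rule measurable_sets[OF \<eta>.measurable_curve B])
    show "AE t in ?U. t \<in> ?f -` ({x\<^sub>1..x\<^sub>2} \<times> {y\<^sub>1..y\<^sub>2}) \<inter> space ?U
        \<longleftrightarrow> t \<in> \<eta> -` ?B \<inter> space ?U"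
      using simple AE_space
    proof eventually_elim
      case (elim t)
      have t: "t \<in> {0..1}" using elim(2) by (simp add: space_restrict_space)
      have "\<eta> t \<in> \<eta> ` {x\<^sub>1..x\<^sub>2} \<longleftrightarrow> t \<in> {x\<^sub>1..x\<^sub>2}"
      proof
        assume "\<eta> t \<in> \<eta> ` {x\<^sub>1..x\<^sub>2}"
        then obtain s where s: "s \<in> {x\<^sub>1..x\<^sub>2}" "\<eta> s = \<eta> t" by auto
        then have "s \<in> {0..1}" using assms(3,4) by auto
        with s have "s = t" using elim(1) t by blast
        with s show "t \<in> {x\<^sub>1..x\<^sub>2}" by simp
      qed simp
      moreover have "\<eta> t \<in> \<zeta> ` {y\<^sub>1..y\<^sub>2} \<longleftrightarrow> first_hit \<zeta> (\<eta> t) \<in> {y\<^sub>1..y\<^sub>2}"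
      proof
        assume "\<eta> t \<in> \<zeta> ` {y\<^sub>1..y\<^sub>2}"
        then obtain s where s: "s \<in> {y\<^sub>1..y\<^sub>2}" "\<zeta> s = \<eta> t" by auto
        then have "s \<in> {0..1}" using assms(5,6) by auto
        \<comment> \<open>The point is visited by \<open>\<zeta>\<close> at time s and at its first
          hitting time, and simplicity identifies the two.\<close>
        with s have "s = first_hit \<zeta> (\<eta> t)"
          using elim(1) \<zeta>.first_hit_range \<zeta>.curve_first_hit by blast
        with s show "first_hit \<zeta> (\<eta> t) \<in> {y\<^sub>1..y\<^sub>2}" by simp
      next
        assume "first_hit \<zeta> (\<eta> t) \<in> {y\<^sub>1..y\<^sub>2}"
        then show "\<eta> t \<in> \<zeta> ` {y\<^sub>1..y\<^sub>2}" by (metis imageI \<zeta>.curve_first_hit)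
      qed
      ultimately show ?case using elim(2) by auto
    qed
  qed
  also have "\<dots> = emeasure (distr ?U \<mu> \<eta>) ?B"
    using B by (simp add: emeasure_distr)
  finally show ?thesis by (simp add: \<eta>.distr_curve)
qed

theorem proposition1p13:
  fixes \<gamma> \<theta> :: real
    and M :: "'a measure"
    and h h' :: "'a \<Rightarrow> functional"
    and \<eta>\<^sub>0 \<eta>\<^sub>\<theta> :: "'a \<Rightarrow> real \<Rightarrow> complex option"
  assumes "0 < \<gamma>" and "\<gamma> < 2"
    and "- pi / 2 \<le> \<theta>" and "\<theta> \<le> pi / 2"
    and "prob_space M"
    and "unit_area_quantum_sphere \<gamma> M h"
    and "whole_plane_gff_mod M (2 * pi * chi \<gamma>) h'"
    and "prob_space.indep_set M (rv_events M dist_algebra h) (mod_events M (2 * pi * chi \<gamma>) h')"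
    and "counterflow_line \<gamma> M h' 0 \<eta>\<^sub>0"
    and "counterflow_line \<gamma> M h' (\<theta> - pi / 2) \<eta>\<^sub>\<theta>"
    and "AE \<omega> in M. \<forall>s t. 0 \<le> s \<and> s < t \<and> t \<le> 1 \<longrightarrow>
           emeasure (sphere_area \<gamma> (h \<omega>)) (\<eta>\<^sub>0 \<omega> ` {s..t}) = ennreal (t - s) \<and>
           emeasure (sphere_area \<gamma> (h \<omega>)) (\<eta>\<^sub>\<theta> \<omega> ` {s..t}) = ennreal (t - s)"
  shows "AE \<omega> in M. \<forall>x\<^sub>1 x\<^sub>2 y\<^sub>1 y\<^sub>2.
           0 \<le> x\<^sub>1 \<and> x\<^sub>1 \<le> x\<^sub>2 \<and> x\<^sub>2 \<le> 1 \<and> 0 \<le> y\<^sub>1 \<and> y\<^sub>1 \<le> y\<^sub>2 \<and> y\<^sub>2 \<le> 1 \<longrightarrow>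
           emeasure (graph_measure (\<lambda>t. first_hit (\<eta>\<^sub>\<theta> \<omega>) (\<eta>\<^sub>0 \<omega> t))) ({x\<^sub>1..x\<^sub>2} \<times> {y\<^sub>1..y\<^sub>2})
           = emeasure (sphere_area \<gamma> (h \<omega>)) (\<eta>\<^sub>0 \<omega> ` {x\<^sub>1..x\<^sub>2} \<inter> \<eta>\<^sub>\<theta> \<omega> ` {y\<^sub>1..y\<^sub>2})"
proof -
  \<comment> \<open>Continuity and surjectivity, as the locale demands them, are read off from
    \<open>counterflow_line\<close>; the areas of arcs are supplied by
    \<open>assms(11)\<close>.\<close>
  have curve: "AE \<omega> in M. continuous_map (top_of_set {0..1}) sphere_top (\<eta>' \<omega>) \<and> \<eta>' \<omega> ` {0..1} = UNIV"
    if "counterflow_line \<gamma> M h' \<beta> \<eta>'" for \<beta> \<eta>'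
  proof -
    from that obtain L R where
      "AE \<omega> in M.
           continuous_map (top_of_set {0..1}) sphere_top (\<eta>' \<omega>) \<and>
           \<eta>' \<omega> 0 = None \<and> \<eta>' \<omega> 1 = None \<and> \<eta>' \<omega> ` {0..1} = UNIV \<and>
           (\<forall>z\<in>rational_points. \<forall>w\<in>rational_points. z \<noteq> w \<longrightarrow>
              between_left_right (L w \<omega>) (R w \<omega>) z \<longrightarrow>
              (\<forall>s\<in>{0..1}. \<forall>t\<in>{0..1}. \<eta>' \<omega> s = Some z \<longrightarrow> \<eta>' \<omega> t = Some w \<longrightarrow> s < t))"
      unfolding counterflow_line_def by blast
    then show ?thesis by (rule AE_mp) simp
  qed
  \<comment> \<open>The null set is discarded before a rectangle is chosen, so one exceptional event
    serves all rectangles at once.\<close>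
  show ?thesis
    using curve[OF assms(9)] curve[OF assms(10)] assms(11)
  proof eventually_elim
    case (elim \<omega>)
    then have "area_parametrized_curve (sphere_area \<gamma> (h \<omega>)) (\<eta>\<^sub>0 \<omega>)"
      "area_parametrized_curve (sphere_area \<gamma> (h \<omega>)) (\<eta>\<^sub>\<theta> \<omega>)"
      by (simp_all add: area_parametrized_curve_def sphere_area_def)
    then show ?case by (simp add: graph_measure_rectangle)
  qed
qed

end
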